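(* For integers $n, m \geq 0$, let $D_{2,2}(n, m)$ be the number of partitions of $n$ into $m$ parts $\lambda_1 \leq \cdots \leq \lambda_m$ such that $\lambda_{i+1} - \lambda_i \geq 2$ for all $i$, and $\lambda_{i+1} - \lambda_i \geq 3$ unless $\lambda_i$ and $\lambda_{i+1}$ are both odd. Let $D_{2,1}(n, m)$ be the number of such partitions (counted by $D_{2,2}(n,m)$) in which the smallest part is at least $3$. Then \[ \sum_{m, n \geq 0} D_{2,2}(n, m) q^n x^m = \sum_{n_1, n_2 \geq 0} \frac{ q^{4n_2^2 + (3n_1^2 - n_1)/2 + 4n_2 n_1} x^{2n_2 + n_1} }{ (q; q)_{n_1} (q^4; q^4)_{n_2} }, \] \[ \sum_{m, n \geq 0} D_{2,1}(n, m) q^n x^m = \sum_{n_1, n_2 \geq 0} \frac{ q^{4n_2^2 + 4n_2 + (3n_1^2 + 3n_1)/2 + 4n_2 n_1} x^{2n_2 + n_1} }{ (q; q)_{n_1} (q^4; q^4)_{n_2} }. \]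
   Context: A partition of $n$ into $m$ parts is a non-decreasing sequence of $m$ positive integers summing to $n$. For $n \geq 0$, $(a; q)_n = \prod_{j=1}^{n} (1 - a q^{j-1})$, with the empty product equal to $1$. *)

theory Defs
  imports "HOL-Analysis.Analysis" "HOL-Computational_Algebra.Formal_Power_Series"
begin

definition partitions_into :: "nat \<Rightarrow> nat \<Rightarrow> nat list set" where
  "partitions_into n m =
     {ps. length ps = m \<and> sum_list ps = n \<and> sorted ps \<and> (\<forall>p\<in>set ps. p > 0)}"

text \<open>Differences are written additively, so natural-number subtraction plays no role.\<close>

definition parts_D22 :: "nat \<Rightarrow> nat \<Rightarrow> nat list set" where
  "parts_D22 n m =
     {ps \<in> partitions_into n m.
        \<forall>i. Suc i < m \<longrightarrow>
          ps ! Suc i \<ge> ps ! i + 2 \<and>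
          (\<not> (odd (ps ! i) \<and> odd (ps ! Suc i)) \<longrightarrow> ps ! Suc i \<ge> ps ! i + 3)}"

definition D22 :: "nat \<Rightarrow> nat \<Rightarrow> nat" where
  "D22 n m = card (parts_D22 n m)"

text \<open>The bound on the smallest part is vacuous for the empty partition, so \<open>D21 0 0 = 1\<close>.\<close>

definition D21 :: "nat \<Rightarrow> nat \<Rightarrow> nat" where
  "D21 n m = card {ps \<in> parts_D22 n m. \<forall>p\<in>set ps. p \<ge> 3}"

lemma finite_parts_D22: "finite (parts_D22 n m)"
proof (rule finite_subset)
  show "parts_D22 n m \<subseteq> {xs. set xs \<subseteq> {..n} \<and> length xs = m}"
    by (auto simp: parts_D22_def partitions_into_def dest: member_le_sum_list)
  show "finite {xs. set xs \<subseteq> {..n} \<and> length xs = m}"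
    by (rule finite_lists_length_eq) simp
qed

definition q_poch :: "'a :: comm_ring_1 \<Rightarrow> 'a \<Rightarrow> nat \<Rightarrow> 'a" where
  "q_poch a q n = (\<Prod>j=1..n. 1 - a * q ^ (j - 1))"

text \<open>
  Formal power series in \<open>q\<close> and \<open>x\<close> are modelled as series in \<open>q\<close> whose coefficients are
  series in \<open>x\<close>. The metric on the outer series type is the \<open>q\<close>-adic one, and with respect to it
  all infinite sums considered here converge: only finitely many terms contribute to each power
  of \<open>q\<close>. (With the variables nested the other way round, the sums over partitions would not.)
\<close>

abbreviation var_q :: "rat fps fps" where
  "var_q \<equiv> fps_X"

abbreviation var_x :: "rat fps fps" where
  "var_x \<equiv> fps_const fps_X"

text \<open>
  The coefficient type \<open>rat fps\<close> is not a field, but all denominators below have constant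
  coefficient \<open>1\<close>, and for these \<open>/\<close> is genuine division:
\<close>

lemma fps_fps_divide_mult_cancel:
  fixes f g :: "rat fps fps"
  assumes "fps_nth g 0 = 1"
  shows "f / g * g = f"
proof -
  have s: "subdegree g = 0"
    using assms by (intro subdegreeI) auto
  have "fps_right_inverse g 1 = inverse g"
    unfolding fps_inverse_def[of g] using assms by simp
  moreover have "g * fps_right_inverse g 1 = 1"
    using assms by (intro fps_right_inverse) auto
  ultimately have "g * inverse g = 1"
    by simp
  then show ?thesis
    using s by (simp add: fps_divide_def mult.assoc mult.commute[of _ g])
qed

end

theory Submission
  imports Defs
begin

text \<open>
  Let \<open>A\<^sub>m(q)\<close> be the coefficient of \<open>x\<^sup>m\<close> in the first series. Adding an even number \<open>k\<close> to all
  parts preserves the gap condition, so the partitions with smallest part above \<open>k\<close> contribute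
  \<open>q\<^bsup>km\<^esup> A\<^sub>m\<close>; the case \<open>k = 2\<close> reduces the second identity to the first. Splitting by whether the
  smallest part is \<open>1\<close>, \<open>2\<close> or at least \<open>3\<close> gives a recurrence for \<open>A\<^sub>m\<close>, whence
  \<open>A\<^sub>m = q\<^bsup>m\<^sup>2\<^esup> (-q; q\<^sup>2)\<^sub>m / (q\<^sup>2; q\<^sup>2)\<^sub>m\<close>.

  On the other side, \<open>4n\<^sub>2\<^sup>2 + (3n\<^sub>1\<^sup>2 - n\<^sub>1)/2 + 4n\<^sub>2n\<^sub>1 = m\<^sup>2 + n\<^sub>1(n\<^sub>1 - 1)/2\<close> for \<open>m = n\<^sub>1 + 2n\<^sub>2\<close>, so after
  division by \<open>q\<^bsup>m\<^sup>2\<^esup>\<close> the coefficient of \<open>x\<^sup>m\<close> is that of \<open>z\<^sup>m\<close> in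
  \<open>(-z; q)\<^sub>\<infinity> / (z\<^sup>2; q\<^sup>4)\<^sub>\<infinity> = (-qz; q\<^sup>2)\<^sub>\<infinity> / (z; q\<^sup>2)\<^sub>\<infinity>\<close>, which is \<open>(-q; q\<^sup>2)\<^sub>m / (q\<^sup>2; q\<^sup>2)\<^sub>m\<close> by the
  \<open>q\<close>-binomial theorem. Infinite products are replaced by the functional equations relating
  \<open>h(z)\<close> and \<open>h(qz)\<close> that characterise them.
\<close>

unbundle no vec_syntax
unbundle fps_syntax


section \<open>Partitions with a gap condition\<close>

definition gap_partitions :: "(nat \<Rightarrow> nat \<Rightarrow> bool) \<Rightarrow> nat \<Rightarrow> nat \<Rightarrow> nat \<Rightarrow> nat list set" where
  "gap_partitions R c n m =
     {ps. length ps = m \<and> sum_list ps = n \<and> sorted_wrt R ps \<and> (\<forall>p\<in>set ps. c \<le> p)}"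

definition gap_partitions_fps ::
    "(nat \<Rightarrow> nat \<Rightarrow> bool) \<Rightarrow> nat \<Rightarrow> nat \<Rightarrow> 'a :: semiring_1 fps" where
  "gap_partitions_fps R c m = Abs_fps (\<lambda>n. of_nat (card (gap_partitions R c n m)))"

lemma finite_gap_partitions: "finite (gap_partitions R c n m)"
proof (rule finite_subset)
  show "gap_partitions R c n m \<subseteq> {ps. set ps \<subseteq> {..n} \<and> length ps = m}"
    by (auto simp: gap_partitions_def dest: member_le_sum_list)
  show "finite {ps. set ps \<subseteq> {..n} \<and> length ps = m}"
    by (rule finite_lists_length_eq) simp
qed

lemma gap_partitions_0: "gap_partitions R c n 0 = (if n = 0 then {[]} else {})"
  by (auto simp: gap_partitions_def)

lemma gap_partitions_fps_0: "gap_partitions_fps R c 0 = 1"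
  by (simp add: gap_partitions_fps_def fps_eq_iff gap_partitions_0)

lemma gap_partitions_add:
  assumes R: "\<And>a b. R (a + k) (b + k) \<longleftrightarrow> R a b"
  shows "gap_partitions R (c + k) n m =
    map (\<lambda>p. p + k) ` {qs \<in> gap_partitions R c (n - k * m) m. k * m \<le> n}"
proof -
  have map_mem: "map (\<lambda>p. p + k) qs \<in> gap_partitions R (c + k) n m \<longleftrightarrow>
      qs \<in> gap_partitions R c (n - k * m) m \<and> k * m \<le> n" for qs
    by (auto simp: gap_partitions_def sorted_wrt_map R sum_list_addf sum_list_triv)
  show ?thesis
  proof (intro equalityI subsetI)
    fix ps assume ps: "ps \<in> gap_partitions R (c + k) n m"
    define qs where "qs = map (\<lambda>p. p - k) ps"
    have "ps = map (\<lambda>p. p + k) qs"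
      using ps by (auto simp: gap_partitions_def qs_def intro!: map_idI[symmetric])
    with ps map_mem show "ps \<in> map (\<lambda>p. p + k) ` {qs \<in> gap_partitions R c (n - k * m) m. k * m \<le> n}"
      by blast
  qed (use map_mem in blast)
qed

lemma gap_partitions_fps_add:
  assumes "\<And>a b. R (a + k) (b + k) \<longleftrightarrow> R a b"
  shows "gap_partitions_fps R (c + k) m = fps_X ^ (k * m) * gap_partitions_fps R c m"
    (is "?lhs = ?rhs")
proof (rule fps_ext)
  fix n
  have "card (gap_partitions R (c + k) n m) =
      card {qs \<in> gap_partitions R c (n - k * m) m. k * m \<le> n}"
    unfolding gap_partitions_add[of R k, OF assms]
    by (intro card_image inj_on_subset[OF inj_mapI]) (auto simp: inj_def)
  then show "?lhs $ n = ?rhs $ n"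
    by (simp add: gap_partitions_fps_def fps_X_power_mult_nth)
qed

lemma gap_partitions_Suc:
  assumes le: "\<And>a b. R a b \<Longrightarrow> a \<le> b"
    and R_c: "\<And>b. R c b \<longleftrightarrow> d \<le> b"
  shows "gap_partitions R c n (Suc m) =
    (#) c ` {ps \<in> gap_partitions R d (n - c) m. c \<le> n} \<union> gap_partitions R (Suc c) n (Suc m)"
    (is "?L = ?C \<union> ?S")
proof (intro equalityI subsetI)
  fix ps assume ps: "ps \<in> ?L"
  then obtain p qs where Cons: "ps = p # qs"
    by (cases ps) (auto simp: gap_partitions_def)
  then have "c \<le> p" "\<forall>r\<in>set qs. R p r"
    using ps by (auto simp: gap_partitions_def)
  then consider (equal) "p = c" | (greater) "Suc c \<le> p" "\<forall>r\<in>set qs. p \<le> r"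
    using le by fastforce
  then show "ps \<in> ?C \<union> ?S"
  proof cases
    case equal
    then show ?thesis
      using ps Cons R_c by (auto simp: gap_partitions_def)
  next
    case greater
    then show ?thesis
      using ps Cons by (auto simp: gap_partitions_def)
  qed
next
  have "c \<le> d"
    using le R_c by blast
  then show "ps \<in> ?L" if "ps \<in> ?C \<union> ?S" for ps
    using that R_c by (auto simp: gap_partitions_def intro: order_trans)
qed

lemma gap_partitions_fps_Suc:
  assumes "\<And>a b. R a b \<Longrightarrow> a \<le> b" and "\<And>b. R c b \<longleftrightarrow> d \<le> b"
  shows "gap_partitions_fps R c (Suc m) =
    fps_X ^ c * gap_partitions_fps R d m + gap_partitions_fps R (Suc c) (Suc m)"
    (is "?lhs = ?rhs")
proof (rule fps_ext)
  fix n
  define C where "C = (#) c ` {ps \<in> gap_partitions R d (n - c) m. c \<le> n}"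
  have "c \<in> set ps" if "ps \<in> C" for ps
    using that by (auto simp: C_def)
  moreover have "c \<notin> set ps" if "ps \<in> gap_partitions R (Suc c) n (Suc m)" for ps
    using that by (auto simp: gap_partitions_def)
  ultimately have "C \<inter> gap_partitions R (Suc c) n (Suc m) = {}"
    by blast
  moreover have "finite C"
    by (simp add: C_def finite_gap_partitions)
  ultimately have "card (C \<union> gap_partitions R (Suc c) n (Suc m)) =
      card C + card (gap_partitions R (Suc c) n (Suc m))"
    by (intro card_Un_disjoint finite_gap_partitions)
  moreover have "card C = card {ps \<in> gap_partitions R d (n - c) m. c \<le> n}"
    unfolding C_def by (rule card_image) simp
  ultimately show "?lhs $ n = ?rhs $ n"
    using gap_partitions_Suc[of R c d n m, OF assms]
    by (simp add: gap_partitions_fps_def fps_X_power_mult_nth flip: C_def)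
qed


section \<open>The \<open>q\<close>-binomial theorem as a functional equation\<close>

lemma q_poch_0 [simp]: "q_poch a q 0 = 1"
  by (simp add: q_poch_def)

lemma q_poch_Suc: "q_poch a q (Suc n) = q_poch a q n * (1 - a * q ^ n)"
  by (simp add: q_poch_def)

lemma q_poch_self_nonzero:
  fixes q :: "'a :: idom"
  assumes "\<And>n. 0 < n \<Longrightarrow> q ^ n \<noteq> 1"
  shows "q_poch q q n \<noteq> 0"
proof (induction n)
  case (Suc n)
  with assms[of "Suc n"] show ?case
    by (simp add: q_poch_Suc)
qed simp

lemma q_poch_nth_0: "a $ 0 = 0 \<Longrightarrow> q_poch a q n $ 0 = 1"
  by (induction n) (simp_all add: q_poch_Suc)

lemma fps_X_power_neq_1:
  assumes "0 < n"
  shows "fps_X ^ n \<noteq> (1 :: 'a :: semiring_1 fps)"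
proof
  assume "fps_X ^ n = (1 :: 'a fps)"
  from arg_cong[OF this, of "\<lambda>f. f $ 0"] assms show False
    by simp
qed

definition fps_dilate :: "'a :: comm_ring_1 \<Rightarrow> 'a fps \<Rightarrow> 'a fps" where
  "fps_dilate c h = h oo (fps_const c * fps_X)"

lemma fps_dilate_nth [simp]: "fps_dilate c h $ n = c ^ n * h $ n"
  by (simp add: fps_dilate_def)

lemma fps_dilate_dilate: "fps_dilate c (fps_dilate d h) = fps_dilate (c * d) h"
  by (simp add: fps_eq_iff power_mult_distrib mult.assoc)

lemma fps_dilate_mult:
  fixes f g :: "'a :: idom fps"
  shows "fps_dilate c (f * g) = fps_dilate c f * fps_dilate c g"
  by (simp add: fps_dilate_def fps_compose_mult_distrib)

lemma fps_dilate_eq_iff_recurrence: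
  "(1 - fps_const a * fps_X) * h = (1 + fps_const b * fps_X) * fps_dilate q h \<longleftrightarrow>
    (\<forall>n. h $ Suc n * (1 - q ^ Suc n) = (a + b * q ^ n) * h $ n)" (is "?lhs = ?rhs \<longleftrightarrow> _")
proof -
  have "?lhs $ 0 = ?rhs $ 0"
    by simp
  moreover have "?lhs $ Suc n = h $ Suc n - a * h $ n" for n
    by (simp add: left_diff_distrib mult.assoc)
  moreover have "?rhs $ Suc n = q ^ Suc n * h $ Suc n + b * (q ^ n * h $ n)" for n
    by (simp add: distrib_right mult.assoc del: power_Suc)
  moreover have "h $ Suc n - a * h $ n = q ^ Suc n * h $ Suc n + b * (q ^ n * h $ n) \<longleftrightarrow>
      h $ Suc n * (1 - q ^ Suc n) = (a + b * q ^ n) * h $ n" for n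
    by (auto simp: algebra_simps simp del: power_Suc)
  ultimately show ?thesis
    unfolding fps_eq_iff by (metis not0_implies_Suc)
qed

lemma q_binomial_iff:
  fixes h :: "'a :: idom fps"
  assumes q: "\<And>n. 0 < n \<Longrightarrow> q ^ n \<noteq> 1"
  shows "(\<forall>n. h $ n * q_poch q q n = (\<Prod>j<n. a + b * q ^ j)) \<longleftrightarrow>
    h $ 0 = 1 \<and> (1 - fps_const a * fps_X) * h = (1 + fps_const b * fps_X) * fps_dilate q h"
    (is "?coeffs \<longleftrightarrow> _")
  unfolding fps_dilate_eq_iff_recurrence
proof (intro iffI conjI allI)
  assume coeffs: ?coeffs
  then show "h $ 0 = 1"
    by (auto dest: spec[of _ 0])
  fix n
  have "h $ Suc n * (1 - q ^ Suc n) * q_poch q q n = h $ Suc n * q_poch q q (Suc n)"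
    by (simp add: q_poch_Suc mult_ac)
  also have "\<dots> = (a + b * q ^ n) * h $ n * q_poch q q n"
    using coeffs by (simp add: mult_ac)
  finally show "h $ Suc n * (1 - q ^ Suc n) = (a + b * q ^ n) * h $ n"
    using q_poch_self_nonzero[OF q] by simp
next
  assume recurrence: "h $ 0 = 1 \<and> (\<forall>n. h $ Suc n * (1 - q ^ Suc n) = (a + b * q ^ n) * h $ n)"
  show "h $ n * q_poch q q n = (\<Prod>j<n. a + b * q ^ j)" for n
  proof (induction n)
    case 0
    show ?case
      using recurrence by simp
  next
    case (Suc n)
    have "h $ Suc n * q_poch q q (Suc n) = h $ Suc n * (1 - q ^ Suc n) * q_poch q q n"
      by (simp add: q_poch_Suc mult_ac)
    also have "\<dots> = (a + b * q ^ n) * (h $ n * q_poch q q n)"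
      using recurrence by simp
    finally show ?case
      by (simp add: Suc.IH)
  qed
qed

lemma fps_compose_X_power_nth:
  fixes f :: "'a :: semiring_1 fps"
  assumes "0 < k"
  shows "(f oo fps_X ^ k) $ n = (if k dvd n then f $ (n div k) else 0)"
proof -
  have "(f oo fps_X ^ k) $ n = (\<Sum>i=0..n. if k * i = n then f $ i else 0)"
    unfolding fps_compose_nth by (intro sum.cong) (auto simp flip: power_mult)
  also have "\<dots> = (\<Sum>i | i \<le> n \<and> k * i = n. f $ i)"
    by (simp add: sum.inter_filter[symmetric])
  also have "{i. i \<le> n \<and> k * i = n} = (if k dvd n then {n div k} else {})"
    using assms by auto
  finally show ?thesis
    by simp
qed

lemma fps_mult_compose_X_power_nth:
  fixes f g :: "'a :: semiring_1 fps"
  assumes "0 < k"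
  shows "(f * (g oo fps_X ^ k)) $ m = (\<Sum>(i, j) | i + k * j = m. f $ i * g $ j)"
proof -
  have "(\<Sum>(i, j) | i + k * j = m. f $ i * g $ j) =
      (\<Sum>i | i \<le> m \<and> k dvd m - i. f $ i * g $ ((m - i) div k))"
    using assms
    by (intro sum.reindex_bij_witness[of _ "\<lambda>i. (i, (m - i) div k)" fst]) auto
  also have "\<dots> = (\<Sum>i=0..m. f $ i * (g oo fps_X ^ k) $ (m - i))"
    using assms by (intro sum.mono_neutral_cong_left) (auto simp: fps_compose_X_power_nth)
  finally show ?thesis
    by (simp add: fps_mult_nth)
qed

lemma fps_dilate_compose_X_power:
  fixes h :: "'a :: idom fps"
  assumes "0 < k"
  shows "fps_dilate c (h oo fps_X ^ k) = fps_dilate (c ^ k) h oo fps_X ^ k"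
  using assms
  by (auto simp: fps_eq_iff fps_compose_X_power_nth simp flip: power_mult)

text \<open>In product notation, \<open>(-z; q)\<^sub>\<infinity> / (z\<^sup>2; q\<^sup>4)\<^sub>\<infinity> = (-qz; q\<^sup>2)\<^sub>\<infinity> / (z; q\<^sup>2)\<^sub>\<infinity>\<close>.\<close>

lemma fps_dilate_eq_mult_compose_X_squared:
  fixes f g :: "'a :: idom fps"
  assumes f: "f = (1 + fps_X) * fps_dilate q f"
    and g: "(1 - fps_X) * g = fps_dilate (q ^ 4) g"
  defines "h \<equiv> f * (g oo fps_X\<^sup>2)"
  shows "(1 - fps_X) * h = (1 + fps_const q * fps_X) * fps_dilate (q\<^sup>2) h"
proof -
  have "fps_dilate q (1 + fps_X) = 1 + fps_const q * fps_X"
    by (simp add: fps_dilate_def fps_compose_add_distrib)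
  then have "fps_dilate q f = (1 + fps_const q * fps_X) * fps_dilate (q\<^sup>2) f"
    by (subst f) (simp add: fps_dilate_mult fps_dilate_dilate power2_eq_square)
  with f have f_dilate: "f = (1 + fps_X) * (1 + fps_const q * fps_X) * fps_dilate (q\<^sup>2) f"
    by (simp add: mult.assoc)
  have "(1 - fps_X\<^sup>2) * (g oo fps_X\<^sup>2) = (1 - fps_X) * g oo fps_X\<^sup>2"
    by (simp add: fps_compose_mult_distrib fps_compose_sub_distrib)
  also have "\<dots> = fps_dilate (q\<^sup>2) (g oo fps_X\<^sup>2)"
    by (simp add: g fps_dilate_compose_X_power flip: power_mult)
  finally have g_dilate: "(1 - fps_X\<^sup>2) * (g oo fps_X\<^sup>2) = fps_dilate (q\<^sup>2) (g oo fps_X\<^sup>2)" .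
  have "(1 + fps_X) * ((1 - fps_X) * h) = f * ((1 - fps_X\<^sup>2) * (g oo fps_X\<^sup>2))"
    by (simp add: h_def algebra_simps power2_eq_square)
  also have "\<dots> = (1 + fps_X) * ((1 + fps_const q * fps_X) * fps_dilate (q\<^sup>2) h)"
    unfolding g_dilate by (subst f_dilate) (simp add: h_def fps_dilate_mult mult.assoc)
  finally show ?thesis
    using fps_nonzeroI[of "1 + fps_X :: 'a fps" 0] by simp
qed

lemma sum_weighted_antidiagonal_q_poch:
  fixes f g :: "nat \<Rightarrow> 'a :: idom"
  assumes q: "\<And>n. 0 < n \<Longrightarrow> q ^ n \<noteq> 1"
    and f: "\<And>n. f n * q_poch q q n = (\<Prod>j<n. q ^ j)"
    and g: "\<And>n. g n * q_poch (q ^ 4) (q ^ 4) n = 1"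
  shows "(\<Sum>(i, j) | i + 2 * j = m. f i * g j) * q_poch (q\<^sup>2) (q\<^sup>2) m = (\<Prod>j<m. 1 + q ^ (2 * j + 1))"
proof -
  define F where "F = Abs_fps f"
  define G where "G = Abs_fps g"
  have q_power: "(q ^ k) ^ n \<noteq> 1" if "0 < k" "0 < n" for k n
    using q[of "k * n"] that by (simp add: power_mult)
  have F: "F $ 0 = 1" "F = (1 + fps_X) * fps_dilate q F"
    using q_binomial_iff[of q F 0 1, OF q] f by (simp_all add: F_def)
  have G: "G $ 0 = 1" "(1 - fps_X) * G = fps_dilate (q ^ 4) G"
    using q_binomial_iff[of "q ^ 4" G 1 0, OF q_power] g by (simp_all add: G_def)
  define H where "H = F * (G oo fps_X\<^sup>2)"
  have "H $ 0 = 1"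
    by (simp add: H_def F(1) G(1))
  moreover have "(1 - fps_X) * H = (1 + fps_const q * fps_X) * fps_dilate (q\<^sup>2) H"
    unfolding H_def by (rule fps_dilate_eq_mult_compose_X_squared[OF F(2) G(2)])
  ultimately have "H $ m * q_poch (q\<^sup>2) (q\<^sup>2) m = (\<Prod>j<m. 1 + q * (q\<^sup>2) ^ j)"
    using q_binomial_iff[of "q\<^sup>2" H 1 q, OF q_power] by simp
  also have "\<dots> = (\<Prod>j<m. 1 + q ^ (2 * j + 1))"
    by (simp add: mult.commute flip: power_mult)
  finally show ?thesis
    by (simp add: H_def F_def G_def fps_mult_compose_X_power_nth)
qed


section \<open>Unconditional sums of formal power series\<close>

lemma summable_on_fpsI:
  fixes f :: "'a \<Rightarrow> 'b :: ab_group_add fps"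
  assumes "\<And>k. finite {x \<in> A. f x $ k \<noteq> 0}"
  shows "f summable_on A"
proof -
  have "(f has_sum Abs_fps (\<lambda>k. \<Sum>x | x \<in> A \<and> f x $ k \<noteq> 0. f x $ k)) A"
    by (rule has_sum_fpsI) (simp_all add: assms)
  then show ?thesis
    by (rule has_sum_imp_summable)
qed

lemma has_sum_fps_fibres:
  fixes f :: "'a \<Rightarrow> 'b :: ab_group_add fps" and w :: "'a \<Rightarrow> 'c"
  assumes f: "(f has_sum S) A"
    and fibre: "\<And>m. (f has_sum g m) {x \<in> A. w x = m}"
  shows "(g has_sum S) UNIV"
proof (rule has_sum_fpsI)
  fix k
  define B where "B = {x \<in> A. f x $ k \<noteq> 0}"
  have fin: "finite B"
    unfolding B_def by (rule has_sum_fpsD(1)[OF f])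
  have g_nth: "g m $ k = (\<Sum>x | x \<in> B \<and> w x = m. f x $ k)" for m
    unfolding has_sum_fpsD(2)[OF fibre] by (rule sum.cong) (auto simp: B_def)
  have "m \<in> w ` B" if "g m $ k \<noteq> 0" for m
    using that sum.not_neutral_contains_not_neutral unfolding g_nth by fastforce
  then have subset: "{m \<in> UNIV. g m $ k \<noteq> 0} \<subseteq> w ` B"
    by blast
  then show "finite {m \<in> UNIV. g m $ k \<noteq> 0}"
    by (rule finite_subset) (simp add: fin)
  have "S $ k = (\<Sum>x\<in>B. f x $ k)"
    unfolding B_def by (rule has_sum_fpsD(2)[OF f])
  also have "\<dots> = (\<Sum>m\<in>w ` B. g m $ k)"
    unfolding g_nth using fin by (rule sum.image_gen)
  also have "\<dots> = (\<Sum>m | m \<in> UNIV \<and> g m $ k \<noteq> 0. g m $ k)"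
    using fin subset by (intro sum.mono_neutral_right) auto
  finally show "S $ k = (\<Sum>m | m \<in> UNIV \<and> g m $ k \<noteq> 0. g m $ k)" .
qed

lemma has_sum_fps_weightE:
  fixes f :: "'a \<Rightarrow> 'b :: ab_group_add fps" and w :: "'a \<Rightarrow> nat"
  assumes zero: "\<And>x n. n < w x \<Longrightarrow> f x $ n = 0"
    and fin: "\<And>m. finite {x. w x = m}"
  obtains S where "(f has_sum S) UNIV" "((\<lambda>m. \<Sum>x | w x = m. f x) has_sum S) UNIV"
proof
  have "finite {x \<in> UNIV. f x $ n \<noteq> 0}" for n
  proof (rule finite_subset)
    show "{x \<in> UNIV. f x $ n \<noteq> 0} \<subseteq> (\<Union>m\<le>n. {x. w x = m})"
      using zero by (auto simp: not_less[symmetric])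
  qed (simp add: fin)
  then show f: "(f has_sum infsum f UNIV) UNIV"
    by (intro has_sum_infsum summable_on_fpsI)
  show "((\<lambda>m. \<Sum>x | w x = m. f x) has_sum infsum f UNIV) UNIV"
    using f by (rule has_sum_fps_fibres[where w = w]) (simp add: fin)
qed

lemma has_sum_fps_monomials:
  fixes g :: "'a \<Rightarrow> 'b :: ring_1 fps"
  assumes "(g has_sum S) A"
  shows "((\<lambda>(m, n). fps_const (g m $ n) * fps_X ^ n) has_sum S) (A \<times> UNIV)"
proof (rule has_sum_fpsI)
  fix k
  let ?f = "\<lambda>(m, n). fps_const (g m $ n) * fps_X ^ n"
  have f_nth: "?f (m, n) $ k = (if n = k then g m $ k else 0)" for m n
    by simp
  have support: "{p \<in> A \<times> UNIV. ?f p $ k \<noteq> 0} = (\<lambda>m. (m, k)) ` {m \<in> A. g m $ k \<noteq> 0}"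
    by (auto split: if_splits)
  show "finite {p \<in> A \<times> UNIV. ?f p $ k \<noteq> 0}"
    unfolding support by (intro finite_imageI has_sum_fpsD(1)[OF assms])
  have "(\<Sum>p | p \<in> A \<times> UNIV \<and> ?f p $ k \<noteq> 0. ?f p $ k) = (\<Sum>m | m \<in> A \<and> g m $ k \<noteq> 0. g m $ k)"
    unfolding support by (subst sum.reindex) (auto simp: inj_on_def f_nth)
  then show "S $ k = (\<Sum>p | p \<in> A \<times> UNIV \<and> ?f p $ k \<noteq> 0. ?f p $ k)"
    using has_sum_fpsD(2)[OF assms] by simp
qed


section \<open>The gap condition of \<open>D22\<close>\<close>

definition D22_gap :: "nat \<Rightarrow> nat \<Rightarrow> bool" where
  "D22_gap a b \<longleftrightarrow> a + 2 \<le> b \<and> (\<not> (odd a \<and> odd b) \<longrightarrow> a + 3 \<le> b)"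

lemma D22_gap_imp_le: "D22_gap a b \<Longrightarrow> a \<le> b"
  by (simp add: D22_gap_def)

lemma transp_D22_gap: "transp D22_gap"
  by (rule transpI) (auto simp: D22_gap_def)

lemma D22_gap_add_even: "even k \<Longrightarrow> D22_gap (a + k) (b + k) \<longleftrightarrow> D22_gap a b"
  by (auto simp: D22_gap_def)

lemma D22_gap_1_iff: "D22_gap 1 b \<longleftrightarrow> 3 \<le> b"
proof -
  have "4 \<le> b" if "3 \<le> b" "even b"
    using that by presburger
  then show ?thesis
    by (auto simp: D22_gap_def)
qed

lemma D22_gap_2_iff: "D22_gap 2 b \<longleftrightarrow> 5 \<le> b"
  by (auto simp: D22_gap_def)

lemma parts_D22_eq_gap_partitions: "parts_D22 n m = gap_partitions D22_gap 1 n m"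
proof -
  have "sorted ps" if "sorted_wrt D22_gap ps" for ps
    using that by (rule sorted_wrt_mono_rel[rotated]) (rule D22_gap_imp_le)
  then show ?thesis
    by (auto simp: parts_D22_def partitions_into_def gap_partitions_def Suc_le_eq
        sorted_wrt_iff_nth_Suc_transp[OF transp_D22_gap] D22_gap_def)
qed

lemma D22_eq_card: "D22 n m = card (gap_partitions D22_gap 1 n m)"
  by (simp add: D22_def parts_D22_eq_gap_partitions)

lemma D21_eq_card: "D21 n m = card (gap_partitions D22_gap 3 n m)"
proof -
  have "{ps \<in> parts_D22 n m. \<forall>p\<in>set ps. 3 \<le> p} = gap_partitions D22_gap 3 n m"
    by (fastforce simp: parts_D22_eq_gap_partitions gap_partitions_def)
  then show ?thesis
    by (simp add: D21_def)
qed

lemma D22_gap_partitions_fps_add_even: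
  assumes "even k"
  shows "gap_partitions_fps D22_gap (Suc k) m = fps_X ^ (k * m) * gap_partitions_fps D22_gap 1 m"
  using gap_partitions_fps_add[of D22_gap k 1 m] D22_gap_add_even[OF assms] by simp

lemma D22_gap_partitions_fps_Suc:
  fixes G :: "nat \<Rightarrow> nat \<Rightarrow> 'a :: comm_ring_1 fps"
  defines "G \<equiv> gap_partitions_fps D22_gap"
  shows "G 1 (Suc m) * (1 - fps_X ^ (2 * Suc m)) =
    fps_X ^ (2 * m + 1) * (1 + fps_X ^ (2 * m + 1)) * G 1 m"
proof -
  define u v :: "'a fps" where "u = fps_X ^ (2 * m + 1)" and "v = fps_X ^ (2 * Suc m)"
  have u: "fps_X ^ 1 * fps_X ^ (2 * m) = u" "fps_X ^ 2 * fps_X ^ (4 * m) = u * u"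
    unfolding u_def power_add[symmetric] by (rule arg_cong[where f = "power _"]; simp)+
  have G_3: "G 3 l = fps_X ^ (2 * l) * G 1 l" and G_5: "G 5 l = fps_X ^ (4 * l) * G 1 l" for l
    using D22_gap_partitions_fps_add_even[of 2 l] D22_gap_partitions_fps_add_even[of 4 l]
    by (simp_all add: G_def)
  have "G 1 (Suc m) = fps_X ^ 1 * G 3 m + G 2 (Suc m)"
    using gap_partitions_fps_Suc[of D22_gap 1 3 m, OF D22_gap_imp_le D22_gap_1_iff]
    by (simp add: G_def numeral_2_eq_2)
  also have "G 2 (Suc m) = fps_X ^ 2 * G 5 m + G 3 (Suc m)"
    using gap_partitions_fps_Suc[of D22_gap 2 5 m, OF D22_gap_imp_le D22_gap_2_iff]
    by (simp add: G_def)
  finally have first_part: "G 1 (Suc m) = u * G 1 m + (u * u * G 1 m + v * G 1 (Suc m))"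
    by (simp only: G_3 G_5 u v_def flip: mult.assoc)
  have "G 1 (Suc m) * (1 - v) = G 1 (Suc m) - v * G 1 (Suc m)"
    by (simp add: algebra_simps)
  also have "\<dots> = u * G 1 m + u * u * G 1 m"
    unfolding diff_eq_eq add.assoc by (fact first_part)
  also have "\<dots> = u * (1 + u) * G 1 m"
    by (simp add: algebra_simps)
  finally show ?thesis
    by (simp only: u_def v_def)
qed

lemma D22_gap_partitions_fps_product:
  "gap_partitions_fps D22_gap 1 m * q_poch (fps_X\<^sup>2) (fps_X\<^sup>2) m =
     fps_X ^ m\<^sup>2 * (\<Prod>j<m. 1 + fps_X ^ (2 * j + 1) :: 'a :: comm_ring_1 fps)"
    (is "?A m * ?Q m = _ * ?P m")
proof (induction m)
  case 0
  show ?case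
    by (simp add: gap_partitions_fps_0)
next
  case (Suc m)
  have "?A (Suc m) * ?Q (Suc m) = ?A (Suc m) * (1 - fps_X ^ (2 * Suc m)) * ?Q m"
    unfolding q_poch_Suc power_mult power_Suc by (simp only: mult_ac)
  also have "\<dots> = fps_X ^ (2 * m + 1) * (1 + fps_X ^ (2 * m + 1)) * (?A m * ?Q m)"
    by (simp only: D22_gap_partitions_fps_Suc mult.assoc)
  also have "\<dots> = fps_X ^ (m\<^sup>2 + (2 * m + 1)) * (?P m * (1 + fps_X ^ (2 * m + 1)))"
    unfolding Suc.IH by (simp only: power_add mult_ac)
  also have "m\<^sup>2 + (2 * m + 1) = (Suc m)\<^sup>2"
    by (simp add: power2_eq_square)
  finally show ?case
    by (simp only: prod.lessThan_Suc)
qed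


section \<open>The double sums\<close>

lemma fps_fps_divide_eq_iff:
  fixes f g h :: "rat fps fps"
  assumes "g $ 0 = 1"
  shows "f / g = h \<longleftrightarrow> f = h * g"
proof -
  have "g \<noteq> 0"
    using assms by (intro fps_nonzeroI[of _ 0]) simp
  then show ?thesis
    using fps_fps_divide_mult_cancel[OF assms, of f] by (metis mult_right_cancel)
qed

lemma fps_fps_times_divide:
  fixes a f g :: "rat fps fps"
  assumes "g $ 0 = 1"
  shows "a * f / g = a * (f / g)"
  using assms by (simp add: fps_fps_divide_eq_iff fps_fps_divide_mult_cancel mult.assoc)

lemma D22_exponent_eq:
  "4 * j\<^sup>2 + (3 * i\<^sup>2 - i) div 2 + 4 * j * i = (i + 2 * j)\<^sup>2 + (\<Sum>l<i. l :: nat)"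
proof -
  have "3 * i\<^sup>2 - i = i * (i - 1) + i\<^sup>2 * 2"
    by (cases i) (simp_all add: power2_eq_square algebra_simps)
  then have "(3 * i\<^sup>2 - i) div 2 = (\<Sum>l<i. l) + i\<^sup>2"
    using Sum_Ico_nat[of 0 i] by (simp add: atLeast0LessThan)
  then show ?thesis
    by (simp add: power2_eq_square algebra_simps)
qed

lemma D21_exponent_eq:
  "4 * j\<^sup>2 + 4 * j + (3 * i\<^sup>2 + 3 * i) div 2 + 4 * j * i =
     2 * (i + 2 * j) + (4 * j\<^sup>2 + (3 * i\<^sup>2 - i) div 2 + 4 * j * (i :: nat))"
proof -
  have "i \<le> 3 * i\<^sup>2"
    by (cases i) (simp_all add: power2_eq_square)
  then have "3 * i\<^sup>2 + 3 * i = (3 * i\<^sup>2 - i) + 2 * i * 2"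
    by simp
  then have "(3 * i\<^sup>2 + 3 * i) div 2 = (3 * i\<^sup>2 - i) div 2 + 2 * i"
    by simp
  then show ?thesis
    by simp
qed

definition D22_term :: "nat \<Rightarrow> nat \<Rightarrow> rat fps fps" where
  "D22_term i j = var_q ^ (4 * j\<^sup>2 + (3 * i\<^sup>2 - i) div 2 + 4 * j * i)
     / (q_poch var_q var_q i * q_poch (var_q ^ 4) (var_q ^ 4) j)"

lemma D22_term_eq:
  "D22_term i j = var_q ^ (i + 2 * j)\<^sup>2 *
     ((\<Prod>l<i. var_q ^ l) / q_poch var_q var_q i * (1 / q_poch (var_q ^ 4) (var_q ^ 4) j))"
    (is "_ = _ * (?f / ?P * (1 / ?Q))")
proof -
  have P_0: "?P $ 0 = 1" and Q_0: "?Q $ 0 = 1"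
    by (simp_all add: q_poch_nth_0)
  have "var_q ^ (i + 2 * j)\<^sup>2 * (?f / ?P * (1 / ?Q)) * (?P * ?Q) =
      var_q ^ (i + 2 * j)\<^sup>2 * (?f / ?P * ?P) * (1 / ?Q * ?Q)"
    by (simp only: mult_ac)
  also have "\<dots> = var_q ^ (i + 2 * j)\<^sup>2 * ?f"
    by (simp only: fps_fps_divide_mult_cancel P_0 Q_0 mult_1_right)
  also have "\<dots> = var_q ^ (4 * j\<^sup>2 + (3 * i\<^sup>2 - i) div 2 + 4 * j * i)"
    by (simp add: D22_exponent_eq power_add power_sum)
  finally show ?thesis
    unfolding D22_term_def by (subst fps_fps_divide_eq_iff) (simp_all add: P_0 Q_0)
qed

lemma D22_gap_partitions_fps_eq_sum:
  "gap_partitions_fps D22_gap 1 m = (\<Sum>(i, j) | i + 2 * j = m. D22_term i j)"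
proof -
  let ?N = "q_poch (var_q\<^sup>2) (var_q\<^sup>2) m"
  define f where "f i = (\<Prod>l<i. var_q ^ l) / q_poch var_q var_q i" for i
  define g where "g j = 1 / q_poch (var_q ^ 4) (var_q ^ 4) j" for j
  have "f i * q_poch var_q var_q i = (\<Prod>l<i. var_q ^ l)" for i
    by (simp add: f_def fps_fps_divide_mult_cancel q_poch_nth_0)
  moreover have "g j * q_poch (var_q ^ 4) (var_q ^ 4) j = 1" for j
    by (simp add: g_def fps_fps_divide_mult_cancel q_poch_nth_0)
  ultimately have "(\<Sum>(i, j) | i + 2 * j = m. f i * g j) * ?N = (\<Prod>j<m. 1 + var_q ^ (2 * j + 1))"
    by (intro sum_weighted_antidiagonal_q_poch fps_X_power_neq_1)
  moreover have "(\<Sum>(i, j) | i + 2 * j = m. D22_term i j) =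
      var_q ^ m\<^sup>2 * (\<Sum>(i, j) | i + 2 * j = m. f i * g j)"
    unfolding sum_distrib_left by (intro sum.cong) (auto simp: D22_term_eq f_def g_def)
  ultimately have "(\<Sum>(i, j) | i + 2 * j = m. D22_term i j) * ?N =
      var_q ^ m\<^sup>2 * (\<Prod>j<m. 1 + var_q ^ (2 * j + 1))"
    by (simp only: mult.assoc)
  also have "\<dots> = gap_partitions_fps D22_gap 1 m * ?N"
    by (rule D22_gap_partitions_fps_product[symmetric])
  finally have "(\<Sum>(i, j) | i + 2 * j = m. D22_term i j) * ?N = gap_partitions_fps D22_gap 1 m * ?N" .
  moreover have "?N \<noteq> 0"
    by (intro fps_nonzeroI[of _ 0]) (simp add: q_poch_nth_0)
  ultimately show ?thesis
    by simp
qed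

lemma D22_term_nth_eq_0:
  assumes "n < i + 2 * j"
  shows "D22_term i j $ n = 0"
proof -
  have "i + 2 * j \<le> (i + 2 * j)\<^sup>2"
    by (simp add: power2_eq_square)
  with assms have "n < (i + 2 * j)\<^sup>2"
    by (rule less_le_trans)
  then show ?thesis
    by (simp add: D22_term_eq fps_X_power_mult_nth)
qed

lemma D22_gap_generating_function:
  assumes "even k"
  shows "\<exists>F.
    ((\<lambda>(m, n). of_nat (card (gap_partitions D22_gap (Suc k) n m)) * var_q ^ n * var_x ^ m)
       has_sum F) UNIV \<and>
    ((\<lambda>(i, j). var_q ^ (k * (i + 2 * j)) * D22_term i j * var_x ^ (2 * j + i)) has_sum F) UNIV"
proof -
  define f where "f = (\<lambda>(i, j). var_q ^ (k * (i + 2 * j)) * D22_term i j * var_x ^ (2 * j + i))"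
  define g where "g m = gap_partitions_fps D22_gap (Suc k) m * var_x ^ m" for m
  obtain F where F: "(f has_sum F) UNIV"
    and F_fibres: "((\<lambda>m. \<Sum>(i, j) | i + 2 * j = m. f (i, j)) has_sum F) UNIV"
  proof (rule has_sum_fps_weightE[of "\<lambda>(i, j). i + 2 * j" f])
    show "f p $ n = 0" if "n < (case p of (i, j) \<Rightarrow> i + 2 * j)" for p n
      using that by (cases p) (simp add: f_def fps_X_power_mult_nth D22_term_nth_eq_0)
    show "finite {p. (case p of (i, j) \<Rightarrow> i + 2 * j) = m}" for m :: nat
      by (rule finite_subset[of _ "{..m} \<times> {..m}"]) auto
  qed (simp add: case_prod_unfold)
  have "(\<Sum>(i, j) | i + 2 * j = m. f (i, j)) = g m" for m
    unfolding g_def D22_gap_partitions_fps_add_even[OF assms] D22_gap_partitions_fps_eq_sum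
      sum_distrib_left sum_distrib_right
    by (intro sum.cong) (auto simp: f_def add.commute)
  with F_fibres have "(g has_sum F) UNIV"
    by simp
  from has_sum_fps_monomials[OF this]
  have "((\<lambda>(m, n). fps_const (g m $ n) * var_q ^ n) has_sum F) UNIV"
    by simp
  moreover have "fps_const (g m $ n) * var_q ^ n =
      of_nat (card (gap_partitions D22_gap (Suc k) n m)) * var_q ^ n * var_x ^ m" for m n
    by (simp add: g_def gap_partitions_fps_def fps_of_nat[symmetric] mult_ac)
  ultimately show ?thesis
    using F by (auto simp: f_def)
qed

theorem theorem13:
  shows "(\<exists>F.
      ((\<lambda>(m, n). of_nat (D22 n m) * var_q ^ n * var_x ^ m) has_sum F) UNIV \<and>
      ((\<lambda>(n1, n2).
          var_q ^ (4 * n2\<^sup>2 + (3 * n1\<^sup>2 - n1) div 2 + 4 * n2 * n1) * var_x ^ (2 * n2 + n1)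
            / (q_poch var_q var_q n1 * q_poch (var_q ^ 4) (var_q ^ 4) n2)) has_sum F) UNIV) \<and>
    (\<exists>F.
      ((\<lambda>(m, n). of_nat (D21 n m) * var_q ^ n * var_x ^ m) has_sum F) UNIV \<and>
      ((\<lambda>(n1, n2).
          var_q ^ (4 * n2\<^sup>2 + 4 * n2 + (3 * n1\<^sup>2 + 3 * n1) div 2 + 4 * n2 * n1) * var_x ^ (2 * n2 + n1)
            / (q_poch var_q var_q n1 * q_poch (var_q ^ 4) (var_q ^ 4) n2)) has_sum F) UNIV)"
proof -
  have "var_q ^ (4 * j\<^sup>2 + (3 * i\<^sup>2 - i) div 2 + 4 * j * i) * var_x ^ (2 * j + i)
      / (q_poch var_q var_q i * q_poch (var_q ^ 4) (var_q ^ 4) j) =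
      D22_term i j * var_x ^ (2 * j + i)" for i j
    by (simp add: D22_term_def q_poch_nth_0 fps_fps_times_divide mult.commute)
  moreover have "var_q ^ (4 * j\<^sup>2 + 4 * j + (3 * i\<^sup>2 + 3 * i) div 2 + 4 * j * i) * var_x ^ (2 * j + i)
      / (q_poch var_q var_q i * q_poch (var_q ^ 4) (var_q ^ 4) j) =
      var_q ^ (2 * (i + 2 * j)) * D22_term i j * var_x ^ (2 * j + i)" for i j
    unfolding D21_exponent_eq power_add[of _ "2 * (i + 2 * j)"]
    by (simp add: D22_term_def q_poch_nth_0 fps_fps_times_divide mult_ac)
  ultimately show ?thesis
    using D22_gap_generating_function[of 0] D22_gap_generating_function[of 2]
    by (simp add: D22_eq_card D21_eq_card)
qed

end
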